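(* Let $k\ge 2$ be an integer and let $R_k$ be the unique root in $(0,1)$ of the equation $4(1-r)-r^{k-1}(1-2r+5r^2)=0$. For any $f\in\mathcal{B}_k$ with expansion $f(z)=\sum_{n=k}^{\infty}a_nz^n$ and any $r\in[0,R_k]$, the strict inequality $$\sum_{n=k}^{\infty}|a_n|r^n<1$$ is valid.
   Context: $\mathbb{D}=\{z\in\mathbb{C}:|z|<1\}$ is the open unit disk. $\mathcal{B}$ denotes the class of all analytic functions $f$ on $\mathbb{D}$ with $|f(z)|\le 1$ for all $z\in\mathbb{D}$. For $k\in\mathbb{N}$ (positive integers), $\mathcal{B}_k=\{f\in\mathcal{B}: f(0)=\cdots=f^{(k-1)}(0)=0\}$, so each $f\in\mathcal{B}_k$ has a power series $f(z)=\sum_{n=k}^\infty a_nz^n$ on $\mathbb{D}$. The given equation has exactly one root in $(0,1)$ for each $k\ge 2$. *)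

theory Defs
  imports "HOL-Complex_Analysis.Complex_Analysis"
begin

definition schur_class :: "(complex \<Rightarrow> complex) set" where
  "schur_class = {f. f analytic_on ball 0 1 \<and> (\<forall>z\<in>ball 0 1. norm (f z) \<le> 1)}"

definition schur_class_vanishing :: "nat \<Rightarrow> (complex \<Rightarrow> complex) set" where
  "schur_class_vanishing k = {f \<in> schur_class. \<forall>j<k. (deriv ^^ j) f 0 = 0}"

definition is_bohr_root :: "nat \<Rightarrow> real \<Rightarrow> bool" where
  "is_bohr_root k r \<longleftrightarrow>
     r \<in> {0<..<1} \<and> 4 * (1 - r) - r ^ (k - 1) * (1 - 2 * r + 5 * r\<^sup>2) = 0"

definition bohr_root :: "nat \<Rightarrow> real" where
  "bohr_root k = (THE r. is_bohr_root k r)"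

lemma ex1_bohr_root:
  assumes "k \<ge> 2"
  shows "\<exists>!r. is_bohr_root k r"
proof -
  define h :: "real \<Rightarrow> real" where "h = (\<lambda>r. 4 * (1 - r) - r ^ (k - 1) * (1 - 2 * r + 5 * r\<^sup>2))"
  have mono: "h y < h x" if "0 < x" "x < y" for x y
  proof -
    obtain m where m: "k - 1 = Suc m" using assms by (cases "k - 1") auto
    have split: "t ^ (k - 1) * (1 - 2 * t + 5 * t\<^sup>2) = t ^ m * (t - 2 * t\<^sup>2 + 5 * t ^ 3)" for t :: real
      unfolding m by (simp add: algebra_simps power2_eq_square power3_eq_cube)
    have pos: "t - 2 * t\<^sup>2 + 5 * t ^ 3 \<ge> 0" if "t > 0" for t :: real
    proof -
      have "t - 2 * t\<^sup>2 + 5 * t ^ 3 = t * ((1 - t)\<^sup>2 + 4 * t\<^sup>2)"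
        by (simp add: algebra_simps power2_eq_square power3_eq_cube)
      then show ?thesis using that by simp
    qed
    have "(y - 2 * y\<^sup>2 + 5 * y ^ 3) - (x - 2 * x\<^sup>2 + 5 * x ^ 3)
        = (y - x) * ((1 - x - y)\<^sup>2 + 4 * x\<^sup>2 + 3 * x * y + 4 * y\<^sup>2)"
      by (simp add: field_simps power2_eq_square power3_eq_cube)
    moreover have "\<dots> \<ge> 0" using that by simp
    ultimately have "x - 2 * x\<^sup>2 + 5 * x ^ 3 \<le> y - 2 * y\<^sup>2 + 5 * y ^ 3" by linarith
    moreover have "x ^ m \<le> y ^ m" using that by (simp add: power_mono)
    ultimately have "x ^ m * (x - 2 * x\<^sup>2 + 5 * x ^ 3) \<le> y ^ m * (y - 2 * y\<^sup>2 + 5 * y ^ 3)"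
      using pos[of x] that by (intro mult_mono) auto
    then show ?thesis using that unfolding h_def split by argo
  qed
  have "continuous_on {0..1} h" unfolding h_def by (intro continuous_intros)
  moreover have h0: "h 0 = 4" and h1: "h 1 = -4" using assms by (simp_all add: h_def)
  ultimately obtain r where r: "0 \<le> r" "r \<le> 1" "h r = 0"
    using IVT2'[of h 1 0 0] by auto
  then have "0 < r" "r < 1" using h0 h1 by (auto simp: less_le)
  with r(3) have "is_bohr_root k r" by (simp add: is_bohr_root_def h_def)
  moreover have "s = r" if "is_bohr_root k s" for s
    using that \<open>0 < r\<close> r(3) mono[of s r] mono[of r s]
    by (cases s r rule: linorder_cases) (auto simp: is_bohr_root_def h_def)
  ultimately show ?thesis by blast
qed

end

theory Submission
  imports Defs
begin

text \<open>
  Write \<open>b n = \<bar>a (n + k)\<bar>\<close> and \<open>q = 1 - b 0\<^sup>2\<close>. Multiplication by \<open>f\<close> is a contraction of the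
  Hardy space; testing this on \<open>p + d z\<^sup>n\<close> gives
  \<open>(b n)\<^sup>2 + q (\<Sum>0<i<n. (b i)\<^sup>2) \<le> q\<^sup>2\<close>. In particular \<open>b n \<le> q\<close> for \<open>n \<ge> 1\<close>, so the majorant series
  is at most \<open>r\<^sup>k (b 0 + q r / (1 - r))\<close>. Maximising over \<open>b 0\<close> gives
  \<open>r ^ (k - 1) (1 - 2 r + 5 r\<^sup>2) / (4 (1 - r))\<close>, which is at most 1 up to the root. For \<open>q > 0\<close> and \<open>r > 0\<close> the
  bound is strict, because \<open>b 1\<close> and \<open>b 2\<close> cannot both equal \<open>q\<close>; for \<open>q = 0\<close> the sum is \<open>r\<^sup>k\<close>.
\<close>

section \<open>Parseval on roots of unity and comparison of coefficient norms\<close>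

text \<open>The sum is geometric with ratio \<open>\<zeta> m / \<zeta> l\<close>, an
  \<open>N\<close>-th root of unity that equals 1 only if \<open>m = l\<close>.\<close>

lemma sum_roots_of_unity_orthogonal:
  fixes N m l :: nat
  assumes "m < N" "l < N"
  defines "\<zeta> \<equiv> \<lambda>j. cis (2 * pi * real j / real N)"
  shows "(\<Sum>j<N. \<zeta> j ^ m * cnj (\<zeta> j ^ l)) = (if m = l then of_nat N else 0)"
proof -
  define x where "x = \<zeta> m / \<zeta> l"
  \<comment> \<open>Both sides are \<open>cis (2 * pi * i * j / N)\<close>; swapping index and
    exponent exhibits powers of the fixed number \<open>x\<close>.\<close>
  have pow: "\<zeta> j ^ i = \<zeta> i ^ j" for i j
    by (simp add: \<zeta>_def Complex.DeMoivre mult_ac)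
  have cnj: "cnj (\<zeta> l) = inverse (\<zeta> l)"
    by (simp add: \<zeta>_def cis_cnj)
  have "\<zeta> j ^ m * cnj (\<zeta> j ^ l) = x ^ j" for j
    by (simp add: pow[of j] cnj x_def power_divide divide_inverse power_inverse power_mult_distrib)
  then have eq: "(\<Sum>j<N. \<zeta> j ^ m * cnj (\<zeta> j ^ l)) = (\<Sum>j<N. x ^ j)"
    by simp
  have l0: "\<zeta> l \<noteq> 0"
    by (simp add: \<zeta>_def)
  have one: "\<zeta> i ^ N = 1" for i
  proof -
    have "\<zeta> i ^ N = cis (2 * pi * real i)"
      using assms(1) by (simp add: \<zeta>_def Complex.DeMoivre)
    then show ?thesis by simp
  qed
  show ?thesis
  proof (cases "m = l")
    case True
    then show ?thesis unfolding eq using l0 by (simp add: x_def)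
  next
    case False
    have "inj_on \<zeta> {..<N}"
      using Complex.bij_betw_roots_unity[of N] assms(1) by (auto simp: bij_betw_def \<zeta>_def)
    then have "x \<noteq> 1"
      using False assms l0 by (auto simp: x_def inj_on_def)
    then have "(\<Sum>j<N. x ^ j) = (x ^ N - 1) / (x - 1)"
      by (simp add: geometric_sum)
    also have "x ^ N = 1"
      by (simp add: x_def power_divide one)
    finally show ?thesis unfolding eq using False by simp
  qed
qed

text \<open>Expanding the squared norms gives a double sum whose off-diagonal terms vanish by
  orthogonality.\<close>

lemma discrete_parseval:
  fixes u :: "nat \<Rightarrow> complex"
  defines "\<zeta> \<equiv> \<lambda>N j. cis (2 * pi * real j / real N)"
  shows "(\<Sum>j<N. (norm (\<Sum>m<N. u m * \<zeta> N j ^ m))\<^sup>2) = real N * (\<Sum>m<N. (norm (u m))\<^sup>2)"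
proof -
  have "complex_of_real (\<Sum>j<N. (norm (\<Sum>m<N. u m * \<zeta> N j ^ m))\<^sup>2)
      = (\<Sum>j<N. \<Sum>m<N. \<Sum>l<N. u m * cnj (u l) * (\<zeta> N j ^ m * cnj (\<zeta> N j ^ l)))"
    by (simp add: complex_norm_square sum_product mult_ac del: of_real_power)
  also have "\<dots> = (\<Sum>m<N. \<Sum>l<N. u m * cnj (u l) * (\<Sum>j<N. \<zeta> N j ^ m * cnj (\<zeta> N j ^ l)))"
  proof -
    have "(\<Sum>j<N. \<Sum>l<N. u m * cnj (u l) * (\<zeta> N j ^ m * cnj (\<zeta> N j ^ l)))
        = (\<Sum>l<N. u m * cnj (u l) * (\<Sum>j<N. \<zeta> N j ^ m * cnj (\<zeta> N j ^ l)))" for m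
      unfolding sum_distrib_left by (rule sum.swap)
    then show ?thesis
      by (subst sum.swap) (simp only:)
  qed
  also have "\<dots> = (\<Sum>m<N. \<Sum>l<N. if m = l then u m * cnj (u l) * of_nat N else 0)"
    unfolding \<zeta>_def by (intro sum.cong refl) (simp add: sum_roots_of_unity_orthogonal del: complex_cnj_power)
  also have "\<dots> = complex_of_real (real N * (\<Sum>m<N. (norm (u m))\<^sup>2))"
    by (simp add: complex_norm_square sum_distrib_left mult_ac del: of_real_power)
  finally show ?thesis
    using of_real_eq_iff by blast
qed

text \<open>
  Parseval is applied on the circle of radius \<open>\<rho>\<close> to the truncations of the power series at
  the \<open>N\<close>-th roots of unity, where it is a finite identity; the truncation error vanishes as
  \<open>N \<rightarrow> \<infinity>\<close>.
\<close>
lemma sum_norm_coeff_le: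
  fixes c u :: "nat \<Rightarrow> complex"
  assumes sums: "\<And>z. norm z < 1 \<Longrightarrow> (\<lambda>m. c m * z ^ m) sums g z"
    and le: "\<And>z. norm z < 1 \<Longrightarrow> norm (g z) \<le> norm (\<Sum>m<n. u m * z ^ m)"
  shows "(\<Sum>m<K. (norm (c m))\<^sup>2) \<le> (\<Sum>m<n. (norm (u m))\<^sup>2)"
proof -
  define B where "B = (\<Sum>m<n. norm (u m))"
  have *: "(\<Sum>m<K. (norm (c m) * \<rho> ^ m)\<^sup>2) \<le> (\<Sum>m<n. (norm (u m))\<^sup>2)"
    if \<rho>: "0 < \<rho>" "\<rho> < 1" for \<rho> :: real
  proof -
    define e where "e = (\<lambda>m. norm (c m) * \<rho> ^ m)"
    define t where "t = (\<lambda>N. \<Sum>m. e (m + N))"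
    \<comment> \<open>Damped by \<open>\<rho> ^ m\<close> and padded with zeros, so that
      \<open>discrete_parseval\<close> applies with length \<open>N\<close>.\<close>
    define v where "v = (\<lambda>m. if m < n then u m * of_real \<rho> ^ m else 0)"
    \<comment> \<open>An auxiliary point with \<open>\<rho> < norm s < 1\<close>: convergence at
      \<open>s\<close> gives absolute convergence at radius \<open>\<rho>\<close>.\<close>
    define s where "s = (of_real ((1 + \<rho>) / 2) :: complex)"
    have s: "norm s = (1 + \<rho>) / 2"
      unfolding s_def using \<rho> by (simp only: norm_of_real) simp
    have "summable (\<lambda>m. c m * s ^ m)"
      using sums[of s] s \<rho> by (auto simp: sums_iff)
    from powser_insidea[OF this, of "of_real \<rho>"] have sum_e: "summable e"
      using \<rho> s by (simp add: e_def norm_mult norm_power)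
    have e0: "e m \<ge> 0" for m
      using \<rho> by (simp add: e_def)
    have t0: "t N \<ge> 0" for N
      unfolding t_def by (intro suminf_nonneg) (use sum_e e0 summable_iff_shift in auto)
    have t_lim: "t \<longlonglongrightarrow> 0"
      using suminf_exist_split2[OF sum_e] by (simp add: t_def)
    \<comment> \<open>\<open>N \<ge> Suc K\<close> covers the first \<open>K\<close> terms and makes
      \<open>N\<close> positive for cancellation; \<open>N \<ge> n\<close> keeps all of
      \<open>u\<close> in \<open>H\<close>.\<close>
    have bound: "(\<Sum>m<K. (e m)\<^sup>2) \<le> (\<Sum>m<n. (norm (u m))\<^sup>2) + (2 * B * t N + (t N)\<^sup>2)"
      if N: "N \<ge> max (Suc K) n" for N
    proof -
      define \<zeta> where "\<zeta> = (\<lambda>j. cis (2 * pi * real j / real N))"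
      define F where "F = (\<lambda>j. \<Sum>m<N. c m * of_real \<rho> ^ m * \<zeta> j ^ m)"
      define H where "H = (\<lambda>j. \<Sum>m<N. v m * \<zeta> j ^ m)"
      have F_le: "(norm (F j))\<^sup>2 \<le> (norm (H j))\<^sup>2 + (2 * B * t N + (t N)\<^sup>2)" for j
      proof -
        define z where "z = of_real \<rho> * \<zeta> j"
        have z: "norm z = \<rho>"
          using \<rho> by (simp add: z_def \<zeta>_def norm_mult)
        have F_eq: "F j = (\<Sum>m<N. c m * z ^ m)"
          by (simp add: F_def z_def power_mult_distrib mult_ac)
        have "H j = (\<Sum>m<N. if m < n then u m * z ^ m else 0)"
          unfolding H_def by (intro sum.cong) (auto simp: v_def z_def power_mult_distrib)
        also have "\<dots> = (\<Sum>m<n. u m * z ^ m)"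
          using N by (intro sum.mono_neutral_cong_right) auto
        finally have H_eq: "H j = (\<Sum>m<n. u m * z ^ m)" .
        have "(\<lambda>m. c (m + N) * z ^ (m + N)) sums (g z - F j)"
          using sums_split_initial_segment[OF sums[of z], of N] z \<rho> F_eq by simp
        moreover have "(\<lambda>m. e (m + N)) sums t N"
          unfolding t_def by (intro summable_sums) (use sum_e summable_iff_shift in blast)
        ultimately have tail: "norm (g z - F j) \<le> t N"
          by (rule norm_sums_le) (use z in \<open>simp add: e_def norm_mult norm_power\<close>)
        have "norm (F j) \<le> norm (g z) + norm (g z - F j)"
          by (metis norm_minus_commute norm_triangle_sub)
        also have "\<dots> \<le> norm (H j) + t N"
          using le[of z] z \<rho> H_eq tail by simp
        finally have "(norm (F j))\<^sup>2 \<le> (norm (H j) + t N)\<^sup>2"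
          by (intro power_mono) auto
        also have "\<dots> = (norm (H j))\<^sup>2 + (2 * norm (H j) * t N + (t N)\<^sup>2)"
          by (simp add: power2_eq_square algebra_simps)
        finally have 1: "(norm (F j))\<^sup>2 \<le> (norm (H j))\<^sup>2 + (2 * norm (H j) * t N + (t N)\<^sup>2)" .
        \<comment> \<open>Replacing \<open>norm (H j)\<close> by \<open>B\<close> makes the error
          independent of \<open>j\<close>, so averaging over the roots leaves it unchanged.\<close>
        have "norm (H j) \<le> B"
          unfolding H_eq B_def
        proof (rule sum_norm_le)
          fix m
          have "\<rho> ^ m \<le> 1"
            using \<rho> by (intro power_le_one) auto
          then show "norm (u m * z ^ m) \<le> norm (u m)"
            by (simp add: norm_mult norm_power z mult_left_le)
        qed
        then have "norm (H j) * t N \<le> B * t N"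
          using t0 by (rule mult_right_mono)
        with 1 show ?thesis by simp
      qed
      have "real N * (\<Sum>m<K. (e m)\<^sup>2) \<le> real N * (\<Sum>m<N. (e m)\<^sup>2)"
        using N by (intro mult_left_mono sum_mono2) auto
      also have "\<dots> = (\<Sum>j<N. (norm (F j))\<^sup>2)"
        unfolding F_def \<zeta>_def discrete_parseval using \<rho> by (simp add: e_def norm_mult norm_power)
      also have "\<dots> \<le> (\<Sum>j<N. (norm (H j))\<^sup>2 + (2 * B * t N + (t N)\<^sup>2))"
        by (intro sum_mono F_le)
      also have "\<dots> = real N * ((\<Sum>m<N. (norm (v m))\<^sup>2) + (2 * B * t N + (t N)\<^sup>2))"
        unfolding sum.distrib H_def \<zeta>_def discrete_parseval by (simp add: algebra_simps)
      finally have "(\<Sum>m<K. (e m)\<^sup>2) \<le> (\<Sum>m<N. (norm (v m))\<^sup>2) + (2 * B * t N + (t N)\<^sup>2)"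
        using N by (simp add: mult_le_cancel_left)
      also have "(\<Sum>m<N. (norm (v m))\<^sup>2) = (\<Sum>m<n. (norm (v m))\<^sup>2)"
        using N by (intro sum.mono_neutral_right) (auto simp: v_def)
      also have "\<dots> \<le> (\<Sum>m<n. (norm (u m))\<^sup>2)"
      proof (intro sum_mono power_mono)
        fix m
        have "\<rho> ^ m \<le> 1"
          using \<rho> by (intro power_le_one) auto
        then show "norm (v m) \<le> norm (u m)"
          using \<rho> by (simp add: v_def norm_mult norm_power mult_left_le)
      qed auto
      finally show ?thesis by simp
    qed
    have "(\<lambda>N. (\<Sum>m<n. (norm (u m))\<^sup>2) + (2 * B * t N + (t N)\<^sup>2))
        \<longlonglongrightarrow> (\<Sum>m<n. (norm (u m))\<^sup>2) + (2 * B * 0 + 0\<^sup>2)"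
      by (intro tendsto_intros t_lim)
    then have "(\<Sum>m<K. (e m)\<^sup>2) \<le> (\<Sum>m<n. (norm (u m))\<^sup>2) + (2 * B * 0 + 0\<^sup>2)"
      by (rule LIMSEQ_le_const) (use bound in blast)
    then show ?thesis
      by (simp add: e_def)
  qed
  \<comment> \<open>With \<open>K\<close> fixed the left side is a finite sum, continuous in
    \<open>\<rho>\<close>, so \<open>\<rho>\<close> may tend to 1.\<close>
  have lim: "((\<lambda>\<rho>. \<Sum>m<K. (norm (c m) * \<rho> ^ m)\<^sup>2) \<longlongrightarrow> (\<Sum>m<K. (norm (c m) * 1 ^ m)\<^sup>2)) (at_left 1)"
    by (intro tendsto_intros)
  have "eventually (\<lambda>\<rho>::real. \<rho> \<in> {0<..<1}) (at_left 1)"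
    by (rule eventually_at_left_real) simp
  then have "eventually (\<lambda>\<rho>. (\<Sum>m<K. (norm (c m) * \<rho> ^ m)\<^sup>2) \<le> (\<Sum>m<n. (norm (u m))\<^sup>2)) (at_left 1)"
    by eventually_elim (use * in auto)
  from tendsto_upperbound[OF lim this] show ?thesis
    by simp
qed

section \<open>Coefficient inequalities for bounded analytic functions\<close>

text \<open>The norm comparison is applied to \<open>(p + d * z ^ n) * f z\<close>, with
  \<open>p\<close> and \<open>d\<close> chosen afterwards. The middle sum refines
  \<open>norm (A (k + n)) \<le> q\<close> and later yields strictness.\<close>

lemma bounded_coeff_refined:
  fixes A :: "nat \<Rightarrow> complex"
  assumes sums: "\<And>z. norm z < 1 \<Longrightarrow> (\<lambda>m. A m * z ^ m) sums f z"
    and bd: "\<And>z. norm z < 1 \<Longrightarrow> norm (f z) \<le> 1"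
    and zero: "\<And>m. m < k \<Longrightarrow> A m = 0"
    and n: "n > 0"
  defines "q \<equiv> 1 - (norm (A k))\<^sup>2"
  shows "q \<ge> 0"
    and "(norm (A (k + n)))\<^sup>2 + q * (\<Sum>i=1..<n. (norm (A (k + i)))\<^sup>2) \<le> q\<^sup>2"
proof -
  define S where "S = (\<Sum>i=1..<n. (norm (A (k + i)))\<^sup>2)"
  have S0: "S \<ge> 0"
    by (simp add: S_def sum_nonneg)
  have main: "(norm (p * A k))\<^sup>2 + (norm p)\<^sup>2 * S + (norm (p * A (k + n) + d * A k))\<^sup>2
      \<le> (norm p)\<^sup>2 + (norm d)\<^sup>2" for p d
  proof -
    define C where "C = (\<lambda>m. p * A m + (if m < n then 0 else d * A (m - n)))"
    define u where "u = (\<lambda>m. if m = 0 then p else if m = n then d else 0)"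
    have u: "(\<Sum>m<Suc n. u m * z ^ m) = p + d * z ^ n" for z
    proof -
      have "(\<Sum>m<Suc n. u m * z ^ m) = (\<Sum>m\<in>{0, n}. u m * z ^ m)"
        using n by (intro sum.mono_neutral_right) (auto simp: u_def)
      then show ?thesis using n by (simp add: u_def)
    qed
    have u2: "(\<Sum>m<Suc n. (norm (u m))\<^sup>2) = (norm p)\<^sup>2 + (norm d)\<^sup>2"
    proof -
      have "(\<Sum>m<Suc n. (norm (u m))\<^sup>2) = (\<Sum>m\<in>{0, n}. (norm (u m))\<^sup>2)"
        using n by (intro sum.mono_neutral_right) (auto simp: u_def)
      then show ?thesis using n by (simp add: u_def)
    qed
    have "(\<Sum>m<Suc (k + n). (norm (C m))\<^sup>2) \<le> (\<Sum>m<Suc n. (norm (u m))\<^sup>2)"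
    proof (rule sum_norm_coeff_le)
      fix z :: complex assume z: "norm z < 1"
      have "(\<lambda>m. if m < n then 0 else d * A (m - n) * z ^ m) sums (d * z ^ n * f z)"
        by (subst sums_zero_iff_shift[of n, symmetric])
           (use sums_mult[OF sums[OF z], of "d * z ^ n"] in \<open>auto simp: power_add mult_ac\<close>)
      from sums_add[OF sums_mult[OF sums[OF z], of p] this]
      have "(\<lambda>m. p * (A m * z ^ m) + (if m < n then 0 else d * A (m - n) * z ^ m))
          sums (p * f z + d * z ^ n * f z)" .
      then show "(\<lambda>m. C m * z ^ m) sums ((p + d * z ^ n) * f z)"
        by (rule back_subst[of "\<lambda>h. h sums _", OF back_subst[of "\<lambda>x. _ sums x"]])
           (auto simp: C_def algebra_simps)
      show "norm ((p + d * z ^ n) * f z) \<le> norm (\<Sum>m<Suc n. u m * z ^ m)"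
        unfolding u using bd[OF z] by (simp add: norm_mult mult_left_le)
    qed
    moreover have "(\<Sum>m<Suc (k + n). (norm (C m))\<^sup>2) \<ge> (\<Sum>m=k..<Suc (k + n). (norm (C m))\<^sup>2)"
      by (intro sum_mono2) auto
    moreover have "(\<Sum>m=k..<Suc (k + n). (norm (C m))\<^sup>2) = (\<Sum>i<Suc n. (norm (C (k + i)))\<^sup>2)"
      using sum.shift_bounds_nat_ivl[of "\<lambda>m. (norm (C m))\<^sup>2" 0 k "Suc n"]
      by (simp add: atLeast0LessThan add.commute)
    moreover have "(\<Sum>i<Suc n. (norm (C (k + i)))\<^sup>2)
        = (norm (C k))\<^sup>2 + (\<Sum>i=1..<n. (norm (C (k + i)))\<^sup>2) + (norm (C (k + n)))\<^sup>2"
      using n by (simp add: sum.atLeast_Suc_lessThan flip: atLeast0LessThan)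
    \<comment> \<open>For \<open>i < n\<close> the shifted term is absent or has index
      \<open>k + i - n < k\<close>, where \<open>A\<close> vanishes; \<open>d\<close> first enters
      at \<open>k + n\<close>.\<close>
    moreover have Ci: "C (k + i) = p * A (k + i)" if "i < n" for i
      using that by (auto simp: C_def intro!: zero)
    moreover have "(\<Sum>i=1..<n. (norm (C (k + i)))\<^sup>2) = (norm p)\<^sup>2 * S"
      by (simp add: S_def Ci norm_mult power_mult_distrib sum_distrib_left)
    moreover have "C (k + n) = p * A (k + n) + d * A k"
      by (simp add: C_def)
    ultimately show ?thesis
      using u2 n Ci[of 0] by simp
  qed
  from main[of 1 0] have 1: "(norm (A (k + n)))\<^sup>2 + S \<le> q"
    by (simp add: q_def)
  moreover have "(norm (A (k + n)))\<^sup>2 \<ge> 0" by simp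
  ultimately show q0: "q \<ge> 0"
    using S0 by linarith
  have "(norm (A (k + n)))\<^sup>2 + q * S \<le> q\<^sup>2"
  proof (cases "q = 0")
    case True
    with 1 S0 have "(norm (A (k + n)))\<^sup>2 \<le> 0" by linarith
    then show ?thesis using True by simp
  next
    case False
    define x where "x = (norm (A (k + n)))\<^sup>2"
    have ak: "(norm (A k))\<^sup>2 = 1 - q"
      by (simp add: q_def)
    have "of_real q * A (k + n) + cnj (A k) * A (k + n) * A k = A (k + n)"
      by (simp add: q_def complex_norm_square algebra_simps del: of_real_power)
    \<comment> \<open>for \<open>p = q\<close>, this \<open>d\<close> minimises \<open>\<bar>d\<bar>\<^sup>2 - \<bar>p A (k + n) + d A k\<bar>\<^sup>2\<close>\<close>
    with main[of "of_real q" "cnj (A k) * A (k + n)"]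
    have "q\<^sup>2 * (1 - q) + q\<^sup>2 * S + x \<le> q\<^sup>2 + (1 - q) * x"
      using q0 ak by (simp add: norm_mult power_mult_distrib x_def)
    \<comment> \<open>The terms \<open>q\<^sup>2\<close> and \<open>x\<close> cancel, leaving a
      common factor \<open>q\<close> to divide out.\<close>
    then have "q * (x + q * S) \<le> q * q\<^sup>2"
      by (simp add: algebra_simps power2_eq_square)
    then show ?thesis
      using False q0 by (simp add: x_def)
  qed
  then show "(norm (A (k + n)))\<^sup>2 + q * (\<Sum>i=1..<n. (norm (A (k + i)))\<^sup>2) \<le> q\<^sup>2"
    by (simp add: S_def)
qed

section \<open>Real inequalities up to the root\<close>

text \<open>As \<open>k \<ge> 2\<close>, a factor \<open>r\<close> can be split off the power. It
  makes the quadratic, which is not monotone on its own, an increasing cubic, while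
  \<open>4 * (1 - r)\<close> decreases.\<close>

lemma le_bohr_root:
  assumes "k \<ge> 2" "0 \<le> r" "r \<le> bohr_root k"
  shows "r < 1" "r ^ (k - 1) * (1 - 2 * r + 5 * r\<^sup>2) \<le> 4 * (1 - r)"
proof -
  define R where "R = bohr_root k"
  have "is_bohr_root k R"
    unfolding R_def bohr_root_def by (rule theI'[OF ex1_bohr_root[OF assms(1)]])
  then have R: "0 < R" "R < 1" "R ^ (k - 1) * (1 - 2 * R + 5 * R\<^sup>2) = 4 * (1 - R)"
    by (auto simp: is_bohr_root_def)
  have rR: "r \<le> R"
    using assms by (simp add: R_def)
  then show "r < 1"
    using R by simp
  obtain m where m: "k - 1 = Suc m"
    using assms(1) by (cases "k - 1") auto
  have split: "t ^ (k - 1) * (1 - 2 * t + 5 * t\<^sup>2) = t ^ m * (t * ((1 - t)\<^sup>2 + 4 * t\<^sup>2))" for t :: real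
    unfolding m by (simp add: algebra_simps power2_eq_square)
  \<comment> \<open>The second factor is the difference quotient of the cubic, arranged as a sum of
    nonnegative terms.\<close>
  have "R * ((1 - R)\<^sup>2 + 4 * R\<^sup>2) - r * ((1 - r)\<^sup>2 + 4 * r\<^sup>2)
      = (R - r) * ((1 - r - R)\<^sup>2 + 4 * r\<^sup>2 + 3 * r * R + 4 * R\<^sup>2)"
    by (simp add: algebra_simps power2_eq_square)
  also have "\<dots> \<ge> 0"
    using rR R assms by simp
  finally have "r * ((1 - r)\<^sup>2 + 4 * r\<^sup>2) \<le> R * ((1 - R)\<^sup>2 + 4 * R\<^sup>2)"
    by simp
  moreover have "r ^ m \<le> R ^ m"
    using rR assms by (simp add: power_mono)
  ultimately have "r ^ (k - 1) * (1 - 2 * r + 5 * r\<^sup>2) \<le> R ^ (k - 1) * (1 - 2 * R + 5 * R\<^sup>2)"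
    unfolding split using assms R by (intro mult_mono[of "r ^ m"]) auto
  then show "r ^ (k - 1) * (1 - 2 * r + 5 * r\<^sup>2) \<le> 4 * (1 - r)"
    using R rR by simp
qed

lemma bohr_majorant_le:
  fixes r x :: real
  assumes "0 < r" "r < 1" "k > 0"
    and "r ^ (k - 1) * (1 - 2 * r + 5 * r\<^sup>2) \<le> 4 * (1 - r)"
  shows "r ^ k * (x + (1 - x\<^sup>2) * (r / (1 - r))) \<le> 1"
proof -
  \<comment> \<open>This square is exactly the gap in the next inequality; it vanishes at the
    maximiser \<open>x = (1 - r) / (2 * r)\<close>.\<close>
  have "0 \<le> (2 * r * x - (1 - r))\<^sup>2"
    by simp
  then have "4 * r * ((1 - r) * x + (1 - x\<^sup>2) * r) \<le> 1 - 2 * r + 5 * r\<^sup>2"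
    by (simp add: algebra_simps power2_eq_square)
  then have "r ^ (k - 1) * (4 * r * ((1 - r) * x + (1 - x\<^sup>2) * r)) \<le> r ^ (k - 1) * (1 - 2 * r + 5 * r\<^sup>2)"
    using assms by (intro mult_left_mono) auto
  also note assms(4)
  also have "r ^ (k - 1) * (4 * r * ((1 - r) * x + (1 - x\<^sup>2) * r))
      = 4 * (r ^ k * ((1 - r) * x + (1 - x\<^sup>2) * r))"
    using assms(3) by (cases k) auto
  finally have "r ^ k * ((1 - r) * x + (1 - x\<^sup>2) * r) \<le> 1 - r"
    by simp
  moreover have "r ^ k * (x + (1 - x\<^sup>2) * (r / (1 - r))) = r ^ k * ((1 - r) * x + (1 - x\<^sup>2) * r) / (1 - r)"
    using assms by (simp add: field_simps)
  ultimately show ?thesis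
    using assms by simp
qed

section \<open>The strict bound for the majorant series\<close>

theorem corollary1:
  fixes k :: nat and f :: "complex \<Rightarrow> complex" and a :: "nat \<Rightarrow> complex" and r :: real
  assumes "k \<ge> 2"
    and "f \<in> schur_class_vanishing k"
    and "\<And>z. z \<in> ball 0 1 \<Longrightarrow> (\<lambda>n. a (n + k) * z ^ (n + k)) sums f z"
    and "r \<in> {0..bohr_root k}"
  shows "summable (\<lambda>n. norm (a (n + k)) * r ^ (n + k)) \<and>
         (\<Sum>n. norm (a (n + k)) * r ^ (n + k)) < 1"
proof (cases "r = 0")
  case True
  then have "norm (a (n + k)) * r ^ (n + k) = 0" for n
    using assms(1) by (simp add: zero_power)
  then show ?thesis by (simp only: summable_zero suminf_zero) simp
next
  case False
  have r: "0 < r" "r < 1" and rle: "r ^ (k - 1) * (1 - 2 * r + 5 * r\<^sup>2) \<le> 4 * (1 - r)"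
    using le_bohr_root[OF assms(1), of r] assms(4) False by auto
  \<comment> \<open>Only the values \<open>a (n + k)\<close> are tied to \<open>f\<close>; setting
    the lower ones to 0 makes \<open>A\<close> its full Taylor sequence.\<close>
  define A where "A = (\<lambda>m. if m < k then 0 else a m)"
  define b where "b = (\<lambda>n. norm (A (k + n)))"
  define q where "q = 1 - (b 0)\<^sup>2"
  have a_eq: "norm (a (n + k)) = b n" for n
    by (simp add: b_def A_def add.commute)
  have sums: "(\<lambda>m. A m * z ^ m) sums f z" if "norm z < 1" for z
    by (subst sums_zero_iff_shift[of k, symmetric])
       (use assms(3)[of z] that in \<open>auto simp: A_def\<close>)
  have bd: "norm (f z) \<le> 1" if "norm z < 1" for z
    using assms(2) that by (auto simp: schur_class_vanishing_def schur_class_def)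
  note refined = bounded_coeff_refined[OF sums bd, of k]
  have q0: "q \<ge> 0"
    using refined(1)[of 1] by (simp add: q_def b_def A_def)
  have coeff: "(b n)\<^sup>2 + q * (\<Sum>i=1..<n. (b i)\<^sup>2) \<le> q\<^sup>2" if "n > 0" for n
    using refined(2)[OF _ _ _ that] by (simp add: q_def b_def A_def)
  have b0: "b n \<ge> 0" for n
    by (simp add: b_def)
  have b_le: "b n \<le> q" if "n > 0" for n
  proof -
    have "q * (\<Sum>i=1..<n. (b i)\<^sup>2) \<ge> 0"
      using q0 by (simp add: sum_nonneg)
    with coeff[OF that] have "(b n)\<^sup>2 \<le> q\<^sup>2"
      by linarith
    then show ?thesis
      using q0 by (rule power2_le_imp_le)
  qed
  \<comment> \<open>The geometric majorant: \<open>b 0\<close> is kept and every later coefficient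
    is replaced by its bound \<open>q\<close>.\<close>
  define w where "w = (\<lambda>n. (if n = 0 then b 0 else q) * r ^ n)"
  have "(\<lambda>n. w (Suc n)) sums (q * r * (1 / (1 - r)))"
    using sums_mult[OF geometric_sums[of r], of "q * r"] r by (simp add: w_def mult_ac)
  then have w_sums: "w sums (b 0 + q * (r / (1 - r)))"
    using sums_Suc_iff[of w "q * (r / (1 - r))"] by (simp add: w_def add.commute)
  have le_w: "b n * r ^ n \<le> w n" for n
    using b_le[of n] r by (cases n) (auto simp: w_def intro!: mult_right_mono)
  have summ: "summable (\<lambda>n. b n * r ^ n)"
    by (rule summable_comparison_test'[OF sums_summable[OF w_sums]])
       (use le_w b0 r in auto)
  define T where "T = (\<Sum>n. b n * r ^ n)"
  have T: "r ^ k * T < 1"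
  \<comment> \<open>If \<open>q = 0\<close>, all coefficients after \<open>b 0 = 1\<close> vanish,
    and strictness comes from \<open>r ^ k < 1\<close>.\<close>
  proof (cases "q = 0")
    case True
    then have "b 0 = 1"
      using b0[of 0] by (simp add: q_def power2_eq_1_iff)
    moreover have "T \<le> b 0 + q * (r / (1 - r))"
      unfolding T_def by (rule sums_le[OF le_w summable_sums[OF summ] w_sums])
    ultimately have "r ^ k * T \<le> r ^ k"
      using True r by (simp add: mult_left_le)
    also have "\<dots> < 1"
      using r assms(1) by (simp add: power_less_one_iff)
    finally show ?thesis .
  next
    case False
    with q0 have q: "q > 0" by simp
    \<comment> \<open>For \<open>n = 1\<close> the inner sum is empty, so \<open>coeff\<close> does
      not exclude \<open>b 1 = q\<close>. Equality at both indices would turn the case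
      \<open>n = 2\<close> into \<open>q\<^sup>2 + q * q\<^sup>2 \<le> q\<^sup>2\<close>.\<close>
    have "b 1 < q \<or> b 2 < q"
    proof (rule ccontr)
      assume "\<not> ?thesis"
      then have "b 1 = q" "b 2 = q"
        using b_le[of 1] b_le[of 2] by auto
      moreover have "q * q\<^sup>2 > 0"
        using q by simp
      ultimately show False
        using coeff[of 2] by (simp add: numeral_2_eq_2)
    qed
    then obtain i where "b i < q" "i > 0"
      by (metis zero_less_one zero_less_numeral)
    \<comment> \<open>One strict term suffices, since all differences
      \<open>w n - b n * r ^ n\<close> are nonnegative.\<close>
    then have "0 < w i - b i * r ^ i"
      using r by (simp add: w_def)
    moreover have diff: "(\<lambda>n. w n - b n * r ^ n) sums (b 0 + q * (r / (1 - r)) - T)"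
      unfolding T_def by (intro sums_diff w_sums summable_sums summ)
    ultimately have "T < b 0 + q * (r / (1 - r))"
      using suminf_pos2[OF sums_summable[OF diff], of i] le_w sums_unique[OF diff] by simp
    then have "r ^ k * T < r ^ k * (b 0 + q * (r / (1 - r)))"
      using r by simp
    also have "\<dots> \<le> 1"
      unfolding q_def using r rle assms(1) by (intro bohr_majorant_le) auto
    finally show ?thesis .
  qed
  have "(\<lambda>n. r ^ k * (b n * r ^ n)) sums (r ^ k * T)"
    unfolding T_def by (intro sums_mult summable_sums summ)
  then have "(\<lambda>n. norm (a (n + k)) * r ^ (n + k)) sums (r ^ k * T)"
    by (simp add: a_eq power_add mult_ac)
  then show ?thesis
    using T by (simp add: sums_iff)
qed

end
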